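(* Let $\rho$ and $\tau$ be simple types. 1. If $\rho\trianglelefteq\tau$ then $rank(\rho)\le rank(\tau)$. 2. If $\rho\trianglelefteq\tau$ and $\pi$ is a path in (the tree of) $\rho$, then there is a path $\pi'$ in (the tree of) $\tau$ with $w(\pi)\sqsubseteq w(\pi')$.
   Context: Simple types are built from type variables (atoms) $a,b,c,\dots$ (many distinct atoms) with $\to$. Terms are simply typed $\lambda$-terms in Church style. Retraction: $\rho\trianglelefteq\tau$ means that there are a type environment $E$ and terms $C$ (the coder), $D$ (the decoder) with $E,(x:\rho)\vdash C:\tau$, $E\vdash D:\tau\to\rho$, $x\notin FV(D)$, and $DC=_{\beta\eta}x$. The types of the free variables declared in $E$ are arbitrary. Rank: $rank(a)=0$ for an atom $a$, and $rank(\tau_1\to\cdots\to\tau_n\to a)=1+\max\{rank(\tau_i)\mid i=1,\dots,n\}$ for $n\ge1$. Tree of a type: $tree(\sigma_1\to\cdots\to\sigma_n\to a)$ (with $a$ an atom) is the finite tree whose root is labeled $a$ and whose direct subtrees are $tree(\sigma_1),\dots,tree(\sigma_n)$. A path is a path from the root down to some node (not necessarily a leaf). For a path $\pi$, $w(\pi)$ is the word of type variables labeling the nodes of $\pi$, read bottom-up (so the root's label is the last letter). For words $w,v$ over the set of type variables, $w\sqsubseteq^0 v$ iff $w=w'aw''$ and $v=w'aaaw''$ for some letter $a$ and some words $w',w''$; $\sqsubseteq$ is the reflexive and transitive closure of $\sqsubseteq^0$. *)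

theory Defs
  imports Main
begin

datatype 'a ty = Atom 'a | Fun "'a ty" "'a ty" (infixr \<open>\<rightarrow>\<close> 200)

text \<open>A type \<open>\<sigma>\<^sub>1 \<rightarrow> \<dots> \<rightarrow> \<sigma>\<^sub>n \<rightarrow> Atom a\<close> has argument types \<open>[\<sigma>\<^sub>1, \<dots>, \<sigma>\<^sub>n]\<close> and target \<open>a\<close>.\<close>

primrec arg_tys :: "'a ty \<Rightarrow> 'a ty list" where
  "arg_tys (Atom a) = []"
| "arg_tys (\<sigma> \<rightarrow> \<tau>) = \<sigma> # arg_tys \<tau>"

primrec target :: "'a ty \<Rightarrow> 'a" where
  "target (Atom a) = a"
| "target (\<sigma> \<rightarrow> \<tau>) = target \<tau>"

lemma size_arg_tys: "\<sigma> \<in> set (arg_tys \<tau>) \<Longrightarrow> size \<sigma> < size \<tau>"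
  by (induction \<tau>) auto

function rank :: "'a ty \<Rightarrow> nat" where
  "rank \<tau> = (if arg_tys \<tau> = [] then 0 else 1 + Max (rank ` set (arg_tys \<tau>)))"
  by pat_completeness auto
termination by (relation "measure size") (auto simp: size_arg_tys)

declare rank.simps [simp del]

datatype 'a tree = Node 'a "'a tree list"

function tree_of :: "'a ty \<Rightarrow> 'a tree" where
  "tree_of \<tau> = Node (target \<tau>) (map tree_of (arg_tys \<tau>))"
  by pat_completeness auto
termination by (relation "measure size") (auto simp: size_arg_tys)

declare tree_of.simps [simp del]

lemma arg_tys_curried: "arg_tys (foldr Fun \<sigma>s (Atom a)) = \<sigma>s"
  and target_curried: "target (foldr Fun \<sigma>s (Atom a)) = a"
  by (induction \<sigma>s) auto

lemma rank_Atom: "rank (Atom a) = 0"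
  by (simp add: rank.simps)

lemma rank_curried:
  "\<sigma>s \<noteq> [] \<Longrightarrow> rank (foldr Fun \<sigma>s (Atom a)) = 1 + Max (rank ` set \<sigma>s)"
  by (subst rank.simps) (simp add: arg_tys_curried)

lemma tree_of_curried: "tree_of (foldr Fun \<sigma>s (Atom a)) = Node a (map tree_of \<sigma>s)"
  by (subst tree_of.simps) (simp add: arg_tys_curried target_curried)

text \<open>A path from the root to a node is given by the list of child indices, starting from \<open>0\<close>,
  chosen on the way down.\<close>

fun is_path :: "nat list \<Rightarrow> 'a tree \<Rightarrow> bool" where
  "is_path [] t \<longleftrightarrow> True"
| "is_path (i # \<pi>) (Node a ts) \<longleftrightarrow> i < length ts \<and> is_path \<pi> (ts ! i)"

text \<open>The labels along a path, read bottom-up: the label of the root comes last.\<close>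

fun path_word :: "'a tree \<Rightarrow> nat list \<Rightarrow> 'a list" where
  "path_word (Node a ts) [] = [a]"
| "path_word (Node a ts) (i # \<pi>) = path_word (ts ! i) \<pi> @ [a]"

inductive word_le0 :: "'a list \<Rightarrow> 'a list \<Rightarrow> bool" (infix \<open>\<sqsubseteq>\<^sup>0\<close> 50) where
  "w' @ [a] @ w'' \<sqsubseteq>\<^sup>0 w' @ [a, a, a] @ w''"

abbreviation word_le :: "'a list \<Rightarrow> 'a list \<Rightarrow> bool" (infix \<open>\<sqsubseteq>\<close> 50) where
  "w \<sqsubseteq> v \<equiv> word_le0\<^sup>*\<^sup>* w v"

text \<open>Church-style terms up to \<open>\<alpha>\<close>-equivalence, in de Bruijn notation. At top level the free
  indices play the role of variable names.\<close>

datatype 'a trm = Var nat | App "'a trm" "'a trm" | Lam "'a ty" "'a trm"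

primrec FV :: "'a trm \<Rightarrow> nat set" where
  "FV (Var i) = {i}"
| "FV (App s t) = FV s \<union> FV t"
| "FV (Lam T t) = {i. Suc i \<in> FV t}"

primrec lift :: "'a trm \<Rightarrow> nat \<Rightarrow> 'a trm" where
  "lift (Var i) k = (if i < k then Var i else Var (Suc i))"
| "lift (App s t) k = App (lift s k) (lift t k)"
| "lift (Lam T t) k = Lam T (lift t (Suc k))"

text \<open>\<open>subst t s k\<close> replaces the variable \<open>k\<close> by \<open>s\<close> and removes it from the scope, so the indices
  above \<open>k\<close> drop by one.\<close>

primrec subst :: "'a trm \<Rightarrow> 'a trm \<Rightarrow> nat \<Rightarrow> 'a trm" where
  "subst (Var i) s k = (if i < k then Var i else if i = k then s else Var (i - 1))"
| "subst (App t u) s k = App (subst t s k) (subst u s k)"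
| "subst (Lam T t) s k = Lam T (subst t (lift s 0) (Suc k))"

text \<open>In the rule \<open>eta\<close>, \<open>lift s 0\<close> is the general form of a term in which the bound variable
  does not occur.\<close>

inductive beta_eta :: "'a trm \<Rightarrow> 'a trm \<Rightarrow> bool" where
  beta: "beta_eta (App (Lam T s) t) (subst s t 0)"
| eta: "beta_eta (Lam T (App (lift s 0) (Var 0))) s"
| appL: "beta_eta s s' \<Longrightarrow> beta_eta (App s t) (App s' t)"
| appR: "beta_eta t t' \<Longrightarrow> beta_eta (App s t) (App s t')"
| lam: "beta_eta t t' \<Longrightarrow> beta_eta (Lam T t) (Lam T t')"

type_synonym 'a env = "nat \<rightharpoonup> 'a ty"

inductive typing :: "'a env \<Rightarrow> 'a trm \<Rightarrow> 'a ty \<Rightarrow> bool" (\<open>_ \<turnstile> _ : _\<close> [50, 50, 50] 50) where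
  Var: "E i = Some T \<Longrightarrow> E \<turnstile> Var i : T"
| App: "E \<turnstile> s : S \<rightarrow> T \<Longrightarrow> E \<turnstile> t : S \<Longrightarrow> E \<turnstile> App s t : T"
| Lam: "case_nat (Some S) E \<turnstile> t : T \<Longrightarrow> E \<turnstile> Lam S t : S \<rightarrow> T"

text \<open>\<open>\<beta>\<eta>\<close>-equality is an equivalence on well-typed terms: every term on a conversion chain has
  type \<open>T\<close> in \<open>E\<close>. On arbitrary annotated terms the equivalence closure of \<^term>\<open>beta_eta\<close>
  would ignore annotations: \<open>Lam S (App (Lam T (Var 0)) (Var 0))\<close> reduces both to
  \<open>Lam S (Var 0)\<close> and to \<open>Lam T (Var 0)\<close>.\<close>

definition beta_eta_eq :: "'a env \<Rightarrow> 'a trm \<Rightarrow> 'a trm \<Rightarrow> 'a ty \<Rightarrow> bool"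
    (\<open>_ \<turnstile> _ =\<^sub>\<beta>\<^sub>\<eta> _ : _\<close> [50, 50, 50, 50] 50) where
  "E \<turnstile> s =\<^sub>\<beta>\<^sub>\<eta> t : T \<longleftrightarrow>
     E \<turnstile> s : T \<and> E \<turnstile> t : T \<and>
     equivclp (\<lambda>u v. E \<turnstile> u : T \<and> E \<turnstile> v : T \<and> beta_eta u v) s t"

definition retract :: "'a ty \<Rightarrow> 'a ty \<Rightarrow> bool" (infix \<open>\<unlhd>\<close> 50) where
  "\<rho> \<unlhd> \<tau> \<longleftrightarrow> (\<exists>(E :: 'a env) x C D.
     E(x \<mapsto> \<rho>) \<turnstile> C : \<tau> \<and> E \<turnstile> D : \<tau> \<rightarrow> \<rho> \<and> x \<notin> FV D \<and>
     E(x \<mapsto> \<rho>) \<turnstile> App D C =\<^sub>\<beta>\<^sub>\<eta> Var x : \<rho>)"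

end

theory Submission
  imports Defs
begin

text \<open>
  Let \<open>D C = x\<close> with \<open>x : \<rho>\<close> and \<open>\<rho> = \<rho>\<^sub>1 \<rightarrow> \<dots> \<rightarrow> \<rho>\<^sub>m \<rightarrow> a\<close>. Then \<open>D C z\<^sub>1 \<dots> z\<^sub>m\<close> head-reduces to some
  \<open>x M\<^sub>1 \<dots> M\<^sub>m\<close> with \<open>M\<^sub>j = z\<^sub>j\<close>. As \<open>D\<close> does not contain \<open>x\<close>, this head comes from an occurrence of \<open>x\<close>
  in the long normal form of \<open>C\<close>, and every node of that normal form above the occurrence has
  been executed on the way, hence has the same target \<open>a\<close>. So the bound variables in scope there
  have types whose parents are the nodes of \<open>\<tau>\<close> reached by a word \<open>a \<dots> a\<close> of odd length. Now \<open>M\<^sub>j\<close> is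
  again a decoder, this time of \<open>z\<^sub>j : \<rho>\<^sub>j\<close>, and the terms substituted for the bound variables are
  its coders. The argument therefore iterates along the path, provided that a retraction is
  allowed to have several coders. The bound on the rank follows, since \<open>\<sqsubseteq>\<close> does not shorten words.

  Normalisation and the analysis of \<open>\<beta>\<eta>\<close>-equality come from one logical relation over
  type-directed algorithmic equality, for weak head reduction of closures.
\<close>

section \<open>Closures and weak head reduction\<close>

text \<open>Free variables carry their types, and explicit environments make substitution into open
  terms trivial.\<close>

datatype 'a cl = Fr nat "'a ty" | Ap "'a cl" "'a cl" | Clo "'a trm" "nat \<Rightarrow> 'a cl"

text \<open>A variable is the pair of a name and a type, so a substitution may treat
  \<open>Fr n T\<close> and \<open>Fr n S\<close> differently.\<close>

primrec sub :: "(nat \<Rightarrow> 'a ty \<Rightarrow> 'a cl) \<Rightarrow> 'a cl \<Rightarrow> 'a cl" where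
  "sub \<theta> (Fr n T) = \<theta> n T"
| "sub \<theta> (Ap s t) = Ap (sub \<theta> s) (sub \<theta> t)"
| "sub \<theta> (Clo t e) = Clo t (\<lambda>i. sub \<theta> (e i))"

text \<open>Environments are total functions, so a closure may contain infinitely many names. Hence
  the finiteness hypotheses wherever a fresh name is chosen.\<close>

primrec names :: "'a cl \<Rightarrow> nat set" where
  "names (Fr n T) = {n}"
| "names (Ap s t) = names s \<union> names t"
| "names (Clo t e) = (\<Union>i. names (e i))"

inductive wh :: "'a cl \<Rightarrow> 'a cl \<Rightarrow> bool" where
  wh_Var: "wh (Clo (Var i) e) (e i)"
| wh_App: "wh (Clo (App s t) e) (Ap (Clo s e) (Clo t e))"
| wh_Lam: "wh (Ap (Clo (Lam T t) e) u) (Clo t (case_nat u e))"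
| wh_Ap: "wh s s' \<Longrightarrow> wh (Ap s u) (Ap s' u)"

inductive_cases wh_FrE: "wh (Fr n T) s"
inductive_cases wh_LamE: "wh (Clo (Lam T t) e) s"
inductive_cases wh_ApE: "wh (Ap t u) s"

abbreviation spine :: "nat \<Rightarrow> 'a ty \<Rightarrow> 'a cl list \<Rightarrow> 'a cl" where
  "spine n T ms \<equiv> foldl Ap (Fr n T) ms"

section \<open>Determinism of head reduction and uniqueness of the spine reached\<close>

lemma wh_deterministic: "wh s t \<Longrightarrow> wh s t' \<Longrightarrow> t = t'"
proof (induction arbitrary: t' rule: wh.induct)
  case (wh_Var i e)
  then show ?case by (cases rule: wh.cases) auto
next
  case (wh_App s t e)
  then show ?case by (cases rule: wh.cases) auto
next
  case (wh_Lam T t e u)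
  then show ?case by (cases rule: wh.cases) (auto elim: wh_LamE)
next
  case (wh_Ap s s' u)
  from wh_Ap.prems show ?case
  proof (cases rule: wh.cases)
    case wh_Lam
    with wh_Ap.hyps show ?thesis by (auto elim: wh_LamE)
  next
    case wh_Ap
    with local.wh_Ap.IH show ?thesis by auto
  qed
qed

lemma spine_normal: "\<not> wh (spine n T ms) t"
proof (induction ms arbitrary: t rule: rev_induct)
  case (snoc m ms)
  have "foldl Ap (Fr n T) ms \<noteq> Clo u e" for u e
    by (cases ms rule: rev_cases) auto
  with snoc show ?case by (auto elim!: wh_ApE)
qed (auto elim: wh_FrE)

lemma spine_inject: "spine n T ms = spine n' T' ms' \<longleftrightarrow> n = n' \<and> T = T' \<and> ms = ms'"
proof (induction ms arbitrary: ms' rule: rev_induct)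
  case Nil
  then show ?case by (cases ms' rule: rev_cases) auto
next
  case (snoc m ms)
  then show ?case by (cases ms' rule: rev_cases) auto
qed

text \<open>Determinism takes the place of confluence: a spine is normal, so every reduct of
  \<open>s\<close> lies on the one path leading to it.\<close>

lemma whs_to_spine:
  "wh\<^sup>*\<^sup>* s t \<Longrightarrow> wh\<^sup>*\<^sup>* s (spine n T ms) \<Longrightarrow> wh\<^sup>*\<^sup>* t (spine n T ms)"
proof (induction rule: converse_rtranclp_induct)
  case (step y z)
  from step.prems obtain y' where "wh y y'" "wh\<^sup>*\<^sup>* y' (spine n T ms)"
    using step.hyps(1) spine_normal[of n T ms] by (auto elim: converse_rtranclpE)
  with wh_deterministic[OF step.hyps(1)] step.IH show ?case by blast
qed

lemma whs_spine: "wh\<^sup>*\<^sup>* (spine n T ms) t \<Longrightarrow> t = spine n T ms"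
  by (erule converse_rtranclpE) (auto simp: spine_normal)

lemma whs_spine_unique:
  assumes "wh\<^sup>*\<^sup>* s (spine n T ms)" and "wh\<^sup>*\<^sup>* s (spine n' T' ms')"
  shows "n = n' \<and> T = T' \<and> ms = ms'"
  using whs_spine[OF whs_to_spine[OF assms]] spine_inject by metis

lemma whs_Ap: "wh\<^sup>*\<^sup>* s s' \<Longrightarrow> wh\<^sup>*\<^sup>* (Ap s u) (Ap s' u)"
proof (induction rule: rtranclp_induct)
  case (step t t')
  from step.IH wh_Ap[OF step.hyps(2)] show ?case by (rule rtranclp.rtrancl_into_rtrancl)
qed simp

section \<open>Substitution for free variables\<close>

lemma wh_sub: "wh s s' \<Longrightarrow> wh (sub \<theta> s) (sub \<theta> s')"
proof (induction rule: wh.induct)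
  case (wh_Lam T t e u)
  have "(\<lambda>i. sub \<theta> (case_nat u e i)) = case_nat (sub \<theta> u) (\<lambda>i. sub \<theta> (e i))"
    by (auto split: nat.split)
  then show ?case using wh.wh_Lam by simp
next
  case (wh_Var i e)
  then show ?case using wh.wh_Var[of i "\<lambda>i. sub \<theta> (e i)"] by simp
qed (auto intro: wh.intros)

lemma whs_sub: "wh\<^sup>*\<^sup>* s s' \<Longrightarrow> wh\<^sup>*\<^sup>* (sub \<theta> s) (sub \<theta> s')"
proof (induction rule: rtranclp_induct)
  case (step t t')
  from step.IH wh_sub[OF step.hyps(2)] show ?case by (rule rtranclp.rtrancl_into_rtrancl)
qed simp

lemma names_wh: "wh s s' \<Longrightarrow> names s' \<subseteq> names s"
  by (induction rule: wh.induct) (auto split: nat.splits)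

lemma names_whs: "wh\<^sup>*\<^sup>* s s' \<Longrightarrow> names s' \<subseteq> names s"
  by (induction rule: rtranclp_induct) (use names_wh in blast)+

lemma sub_foldl_Ap: "sub \<theta> (foldl Ap s ms) = foldl Ap (sub \<theta> s) (map (sub \<theta>) ms)"
  by (induction ms arbitrary: s) auto

lemma names_foldl_Ap: "names (foldl Ap s ms) = names s \<union> (\<Union>m\<in>set ms. names m)"
  by (induction ms arbitrary: s) auto

lemma sub_cong: "(\<And>n. n \<in> names t \<Longrightarrow> \<theta> n = \<theta>' n) \<Longrightarrow> sub \<theta> t = sub \<theta>' t"
  by (induction t) auto

lemma sub_Fr: "(\<And>n T. n \<in> names t \<Longrightarrow> \<theta> n T = Fr n T) \<Longrightarrow> sub \<theta> t = t"
proof (induction t)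
  case (Clo t e)
  then have "(\<lambda>i. sub \<theta> (e i)) = e" by (intro ext) auto
  then show ?case by simp
qed auto

lemma names_sub: "(\<And>n T. names (\<theta> n T) \<subseteq> A) \<Longrightarrow> names (sub \<theta> t) \<subseteq> A"
  by (induction t) auto

section \<open>Algorithmic equality and its logical relation\<close>

text \<open>A derivation compares eta-long normal forms, so one of \<open>alg \<sigma> t t\<close>
  certifies a finite normal form of \<open>t\<close> and supports induction on it.
  \<open>alg_Fun\<close> asks for every name, not only fresh ones, so transitivity needs no
  renaming.\<close>

inductive alg :: "'a ty \<Rightarrow> 'a cl \<Rightarrow> 'a cl \<Rightarrow> bool" where
  alg_Atom: "wh\<^sup>*\<^sup>* s (spine n T ms) \<Longrightarrow> wh\<^sup>*\<^sup>* t (spine n T ms') \<Longrightarrow> target T = b \<Longrightarrow>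
    length ms = length (arg_tys T) \<Longrightarrow> length ms' = length (arg_tys T) \<Longrightarrow>
    (\<And>i. i < length (arg_tys T) \<Longrightarrow> alg (arg_tys T ! i) (ms ! i) (ms' ! i)) \<Longrightarrow>
    alg (Atom b) s t"
| alg_Fun: "(\<And>n. alg \<tau> (Ap s (Fr n \<sigma>)) (Ap t (Fr n \<sigma>))) \<Longrightarrow> alg (\<sigma> \<rightarrow> \<tau>) s t"

inductive_cases alg_AtomE: "alg (Atom b) s t"
inductive_cases alg_FunE: "alg (\<sigma> \<rightarrow> \<tau>) s t"

lemma alg_sym: "alg \<sigma> s t \<Longrightarrow> alg \<sigma> t s"
  by (induction rule: alg.induct) (blast intro: alg.intros)+

lemma alg_trans: "alg \<sigma> s t \<Longrightarrow> alg \<sigma> t u \<Longrightarrow> alg \<sigma> s u"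
proof (induction arbitrary: u rule: alg.induct)
  case (alg_Atom s n T ms t ms' b)
  from alg_Atom.prems obtain n' T' ms1 ms2 where
    *: "wh\<^sup>*\<^sup>* t (spine n' T' ms1)" "wh\<^sup>*\<^sup>* u (spine n' T' ms2)" "length ms2 = length (arg_tys T')"
      "\<And>i. i < length (arg_tys T') \<Longrightarrow> alg (arg_tys T' ! i) (ms1 ! i) (ms2 ! i)"
    by (elim alg_AtomE) metis
  have "n = n'" "T = T'" "ms' = ms1"
    using whs_spine_unique[OF alg_Atom.hyps(2) *(1)] by auto
  with * alg_Atom show ?case by (auto intro!: alg.alg_Atom)
next
  case (alg_Fun \<tau> s \<sigma> t)
  then show ?case by (auto elim!: alg_FunE intro!: alg.alg_Fun)
qed

text \<open>No Kripke worlds are needed, as every name is available at every type.\<close>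

primrec lr :: "'a ty \<Rightarrow> 'a cl \<Rightarrow> 'a cl \<Rightarrow> bool" where
  "lr (Atom b) = alg (Atom b)"
| "lr (\<sigma> \<rightarrow> \<tau>) = (\<lambda>s t. \<forall>u u'. lr \<sigma> u u' \<longrightarrow> lr \<tau> (Ap s u) (Ap t u'))"

lemma lr_sym: "lr \<sigma> s t \<Longrightarrow> lr \<sigma> t s"
proof (induction \<sigma> arbitrary: s t)
  case (Fun \<sigma>1 \<sigma>2)
  then show ?case unfolding lr.simps by blast
qed (simp add: alg_sym)

lemma lr_trans: "lr \<sigma> s t \<Longrightarrow> lr \<sigma> t u \<Longrightarrow> lr \<sigma> s u"
proof (induction \<sigma> arbitrary: s t u)
  case (Fun \<sigma>1 \<sigma>2)
  show ?case unfolding lr.simps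
  proof (intro allI impI)
    fix v v' assume v: "lr \<sigma>1 v v'"
    \<comment> \<open>A symmetric and transitive relation is reflexive on its field.\<close>
    then have "lr \<sigma>1 v' v'" using lr_sym Fun.IH(1) by blast
    with v Fun.prems have "lr \<sigma>2 (Ap s v) (Ap t v')" "lr \<sigma>2 (Ap t v') (Ap u v')" by simp_all
    then show "lr \<sigma>2 (Ap s v) (Ap u v')" by (rule Fun.IH(2))
  qed
qed (auto intro: alg_trans)

lemma lr_whs: "wh\<^sup>*\<^sup>* s s' \<Longrightarrow> wh\<^sup>*\<^sup>* t t' \<Longrightarrow> lr \<sigma> s' t' \<Longrightarrow> lr \<sigma> s t"
proof (induction \<sigma> arbitrary: s t s' t')
  case (Atom b)
  then have "alg (Atom b) s' t'" by simp
  then show ?case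
  proof (cases rule: alg.cases)
    case (alg_Atom n T ms ms')
    show ?thesis unfolding lr.simps
      by (rule alg.alg_Atom[OF rtranclp_trans[OF Atom(1) alg_Atom(1)]
            rtranclp_trans[OF Atom(2) alg_Atom(2)]])
        (use alg_Atom in simp_all)
  qed
next
  case (Fun \<sigma>1 \<sigma>2)
  show ?case unfolding lr.simps
  proof (intro allI impI)
    fix u u' assume "lr \<sigma>1 u u'"
    with Fun.prems(3) have "lr \<sigma>2 (Ap s' u) (Ap t' u')" by simp
    then show "lr \<sigma>2 (Ap s u) (Ap t u')"
      by (rule Fun.IH(2)[OF whs_Ap[OF Fun.prems(1)] whs_Ap[OF Fun.prems(2)]])
  qed
qed

lemma lr_wh: "wh s s' \<Longrightarrow> wh t t' \<Longrightarrow> lr \<sigma> s' t' \<Longrightarrow> lr \<sigma> s t"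
  by (meson lr_whs r_into_rtranclp)

lemma lr_wh_left: "wh s s' \<Longrightarrow> lr \<sigma> s' t \<Longrightarrow> lr \<sigma> s t"
  by (meson lr_whs r_into_rtranclp rtranclp.rtrancl_refl)

text \<open>The two halves need each other: passing to \<open>alg\<close> at a function type needs
  related variables, and extending a spine needs its new arguments in \<open>alg\<close>. The
  \<open>drop\<close> condition says that \<open>\<sigma>\<close> is what remains of
  \<open>T\<close> after the arguments \<open>ms\<close>.\<close>

lemma lr_alg_spine:
  "(lr \<sigma> s t \<longrightarrow> alg \<sigma> s t) \<and>
   (length ms \<le> length (arg_tys T) \<longrightarrow> length ms' = length ms \<longrightarrow>
    drop (length ms) (arg_tys T) = arg_tys \<sigma> \<longrightarrow> target T = target \<sigma> \<longrightarrow>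
    (\<forall>i<length ms. alg (arg_tys T ! i) (ms ! i) (ms' ! i)) \<longrightarrow>
    lr \<sigma> (spine n T ms) (spine n T ms'))"
proof (induction \<sigma> arbitrary: s t n T ms ms')
  case (Atom b)
  then show ?case by (auto intro!: alg_Atom)
next
  case (Fun \<sigma>1 \<sigma>2)
  have var: "lr \<sigma>1 (Fr n \<sigma>1) (Fr n \<sigma>1)" for n
    using Fun.IH(1)[of "Fr n \<sigma>1" "Fr n \<sigma>1" "[]" \<sigma>1 "[]" n] by simp
  show ?case
  proof (intro conjI impI)
    assume "lr (\<sigma>1 \<rightarrow> \<sigma>2) s t"
    with var Fun.IH(2) show "alg (\<sigma>1 \<rightarrow> \<sigma>2) s t" by (auto intro!: alg_Fun)
  next
    assume len: "length ms \<le> length (arg_tys T)" "length ms' = length ms"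
      and dr: "drop (length ms) (arg_tys T) = arg_tys (\<sigma>1 \<rightarrow> \<sigma>2)"
      and tg: "target T = target (\<sigma>1 \<rightarrow> \<sigma>2)"
      and al: "\<forall>i<length ms. alg (arg_tys T ! i) (ms ! i) (ms' ! i)"
    show "lr (\<sigma>1 \<rightarrow> \<sigma>2) (spine n T ms) (spine n T ms')"
      unfolding lr.simps
    proof (intro allI impI)
      fix u u' assume "lr \<sigma>1 u u'"
      then have u: "alg \<sigma>1 u u'" using Fun.IH(1) by blast
      have lt: "length ms < length (arg_tys T)"
        using dr by (metis arg_tys.simps(2) drop_all leI list.distinct(1))
      then have nth: "arg_tys T ! length ms = \<sigma>1" "drop (Suc (length ms)) (arg_tys T) = arg_tys \<sigma>2"
        using dr by (metis arg_tys.simps(2) Cons_nth_drop_Suc list.inject)+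
      have "lr \<sigma>2 (spine n T (ms @ [u])) (spine n T (ms' @ [u']))"
        by (rule Fun.IH(2)[THEN conjunct2, rule_format])
          (use lt len nth tg al u in \<open>auto simp: nth_append less_Suc_eq\<close>)
      then show "lr \<sigma>2 (Ap (spine n T ms) u) (Ap (spine n T ms') u')" by simp
    qed
  qed
qed

lemma lr_alg: "lr \<sigma> s t \<Longrightarrow> alg \<sigma> s t"
  using lr_alg_spine by blast

lemma lr_Fr: "lr T (Fr n T) (Fr n T)"
  using lr_alg_spine[of T _ _ "[]" T "[]" n] by simp

lemma lr_foldl_Ap:
  "lr T f f' \<Longrightarrow> length ms = length (arg_tys T) \<Longrightarrow> length ms' = length (arg_tys T) \<Longrightarrow>
   (\<And>i. i < length (arg_tys T) \<Longrightarrow> lr (arg_tys T ! i) (ms ! i) (ms' ! i)) \<Longrightarrow>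
   lr (Atom (target T)) (foldl Ap f ms) (foldl Ap f' ms')"
proof (induction T arbitrary: f f' ms ms')
  case (Fun \<sigma> \<tau>)
  obtain m ns m' ns' where ms: "ms = m # ns" "ms' = m' # ns'"
    using Fun.prems(2,3) by (cases ms; cases ms') auto
  have "lr \<sigma> m m'" using Fun.prems(4)[of 0] ms by simp
  then have "lr \<tau> (Ap f m) (Ap f' m')" using Fun.prems(1) by simp
  then have "lr (Atom (target \<tau>)) (foldl Ap (Ap f m) ns) (foldl Ap (Ap f' m') ns')"
  proof (rule Fun.IH(2))
    show "lr (arg_tys \<tau> ! i) (ns ! i) (ns' ! i)" if "i < length (arg_tys \<tau>)" for i
      using Fun.prems(4)[of "Suc i"] that ms by simp
  qed (use Fun.prems(2,3) ms in simp_all)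
  then show ?case using ms by simp
qed simp

lemma alg_foldl_Fr:
  "alg T s t \<Longrightarrow> alg (Atom (target T)) (foldl Ap s (map (Fr z) (arg_tys T)))
    (foldl Ap t (map (Fr z) (arg_tys T)))"
proof (induction T arbitrary: s t)
  case (Fun \<sigma> \<tau>)
  then have "alg \<tau> (Ap s (Fr z \<sigma>)) (Ap t (Fr z \<sigma>))" by (blast elim: alg_FunE)
  from Fun.IH(2)[OF this] show ?case by simp
qed simp

section \<open>Convertible terms are algorithmically equal\<close>

text \<open>Fundamental lemma: each typing rule is matched by one head step of closures, and
  \<open>lr\<close> is closed under head expansion.\<close>

lemma lr_typing:
  "E \<turnstile> t : T \<Longrightarrow> (\<And>i S. E i = Some S \<Longrightarrow> lr S (e i) (e' i)) \<Longrightarrow> lr T (Clo t e) (Clo t e')"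
proof (induction arbitrary: e e' rule: typing.induct)
  case (Var E i T)
  show ?case by (rule lr_wh[OF wh_Var wh_Var]) (rule Var.prems[OF Var.hyps])
next
  case (App E s S T t)
  have "lr T (Ap (Clo s e) (Clo t e)) (Ap (Clo s e') (Clo t e'))"
    using App.IH[of e e'] App.prems by simp
  then show ?case by (rule lr_wh[OF wh_App wh_App])
next
  case (Lam S E t T)
  show ?case unfolding lr.simps
  proof (intro allI impI)
    fix u u' assume u: "lr S u u'"
    have "lr T (Clo t (case_nat u e)) (Clo t (case_nat u' e'))"
    proof (rule Lam.IH)
      show "lr V (case_nat u e i) (case_nat u' e' i)" if "case_nat (Some S) E i = Some V" for i V
        using that u Lam.prems[of "i - 1" V] by (cases i) auto
    qed
    then show "lr T (Ap (Clo (Lam S t) e) u) (Ap (Clo (Lam S t) e') u')"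
      by (rule lr_wh[OF wh_Lam wh_Lam])
  qed
qed

section \<open>Lifting and substitution up to the logical relation\<close>

lemma typing_lift:
  "E \<turnstile> t : T \<Longrightarrow> (\<And>i S. E i = Some S \<Longrightarrow> E' (if i < k then i else Suc i) = Some S) \<Longrightarrow>
   E' \<turnstile> lift t k : T"
proof (induction arbitrary: E' k rule: typing.induct)
  case (Var E i T)
  from typing.Var[of E', OF Var.prems[OF Var.hyps]] show ?case by (simp split: if_splits)
next
  case (App E s S T t)
  show ?case unfolding lift.simps
    by (rule typing.App[OF App.IH]) (use App.prems in blast)+
next
  case (Lam S E t T)
  have "case_nat (Some S) E' \<turnstile> lift t (Suc k) : T"
  proof (rule Lam.IH)
    fix i U assume "case_nat (Some S) E i = Some U"
    then show "case_nat (Some S) E' (if i < Suc k then i else Suc i) = Some U"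
      using Lam.prems[of "i - 1" U] by (cases i) (auto split: if_splits)
  qed
  then show ?case unfolding lift.simps by (rule typing.Lam)
qed

lemma lr_lift:
  "E \<turnstile> t : T \<Longrightarrow> (\<And>i S. E i = Some S \<Longrightarrow> lr S (e' (if i < k then i else Suc i)) (e i)) \<Longrightarrow>
   lr T (Clo (lift t k) e') (Clo t e)"
proof (induction arbitrary: e e' k rule: typing.induct)
  case (Var E i T)
  have "wh (Clo (lift (Var i) k) e') (e' (if i < k then i else Suc i))" by (auto intro: wh_Var)
  then show ?case by (rule lr_wh[OF _ wh_Var]) (rule Var.prems[OF Var.hyps])
next
  case (App E s S T t)
  have "lr T (Ap (Clo (lift s k) e') (Clo (lift t k) e')) (Ap (Clo s e) (Clo t e))"
    using App.IH[of e' k e] App.prems by simp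
  from lr_wh[OF wh_App wh_App this] show ?case by simp
next
  case (Lam S E t T)
  show ?case unfolding lr.simps lift.simps
  proof (intro allI impI)
    fix u u' assume u: "lr S u u'"
    have "lr T (Clo (lift t (Suc k)) (case_nat u e')) (Clo t (case_nat u' e))"
    proof (rule Lam.IH)
      fix i U assume "case_nat (Some S) E i = Some U"
      then show "lr U (case_nat u e' (if i < Suc k then i else Suc i)) (case_nat u' e i)"
        using Lam.prems[of "i - 1" U] u by (cases i) (auto split: if_splits)
    qed
    then show "lr T (Ap (Clo (Lam S (lift t (Suc k))) e') u) (Ap (Clo (Lam S t) e) u')"
      by (rule lr_wh[OF wh_Lam wh_Lam])
  qed
qed

text \<open>Substituting in the term and extending the environment give different closures, so they
  agree only up to \<open>lr\<close>. Here \<open>e'\<close> interprets the result and the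
  substituted \<open>t\<close>, while \<open>e\<close> interprets \<open>s\<close>.\<close>

lemma lr_subst:
  "F \<turnstile> s : S \<Longrightarrow> G \<turnstile> t : U \<Longrightarrow> F k = Some U \<Longrightarrow>
   (\<And>i V. G i = Some V \<Longrightarrow> lr V (e' i) (e' i)) \<Longrightarrow>
   (\<And>i V. F i = Some V \<Longrightarrow>
     lr V (if i < k then e' i else if i = k then Clo t e' else e' (i - 1)) (e i)) \<Longrightarrow>
   lr S (Clo (subst s t k) e') (Clo s e)"
proof (induction arbitrary: G t k e e' rule: typing.induct)
  case (Var F i T)
  note 1 = lr_sym[OF lr_wh_left[OF wh_Var[of i e] lr_sym[OF Var.prems(4)[OF Var.hyps]]]]
  show ?case
  proof (cases "i = k")
    case False
    have "wh (Clo (subst (Var i) t k) e') (if i < k then e' i else e' (i - 1))"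
      using False by (auto intro: wh_Var)
    then show ?thesis by (rule lr_wh_left) (use False 1 in auto)
  qed (use 1 in simp)
next
  case (App F s S T t')
  have "lr T (Ap (Clo (subst s t k) e') (Clo (subst t' t k) e')) (Ap (Clo s e) (Clo t' e))"
    using App.IH(1)[OF App.prems] App.IH(2)[OF App.prems] by simp
  from lr_wh[OF wh_App wh_App this] show ?case by simp
next
  case (Lam S F s T)
  show ?case unfolding lr.simps subst.simps
  proof (intro allI impI)
    fix u u' assume u: "lr S u u'"
    then have uu: "lr S u u" using lr_sym lr_trans by blast
    have "lr T (Clo (subst s (lift t 0) (Suc k)) (case_nat u e')) (Clo s (case_nat u' e))"
    proof (rule Lam.IH)
      show "case_nat (Some S) G \<turnstile> lift t 0 : U"
        by (rule typing_lift[OF Lam.prems(1)]) simp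
      show "case_nat (Some S) F (Suc k) = Some U" using Lam.prems by simp
      show "lr V (case_nat u e' i) (case_nat u e' i)" if "case_nat (Some S) G i = Some V" for i V
        using that Lam.prems(3) uu by (auto split: nat.splits)
      fix i V assume i: "case_nat (Some S) F i = Some V"
      show "lr V (if i < Suc k then case_nat u e' i else if i = Suc k
          then Clo (lift t 0) (case_nat u e') else case_nat u e' (i - 1)) (case_nat u' e i)"
      proof (cases i)
        case 0
        then show ?thesis using i u by simp
      next
        case (Suc j)
        have j: "F j = Some V" using i Suc by simp
        show ?thesis
        proof (cases "j = k")
          case True
          then have "V = U" using j Lam.prems(2) by simp
          \<comment> \<open>Lifting makes \<open>t\<close> ignore the entry \<open>u\<close> of the
            new binder.\<close>
          moreover have "lr U (Clo (lift t 0) (case_nat u e')) (Clo t e')"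
            by (rule lr_lift[OF Lam.prems(1)]) (use Lam.prems(3) in auto)
          ultimately show ?thesis
            using lr_trans[OF _ Lam.prems(4)[OF j]] True Suc by simp
        next
          case False
          then show ?thesis using Lam.prems(4)[OF j] Suc by (cases j) auto
        qed
      qed
    qed
    then show "lr T (Ap (Clo (Lam S (subst s (lift t 0) (Suc k))) e') u) (Ap (Clo (Lam S s) e) u')"
      by (rule lr_wh[OF wh_Lam wh_Lam])
  qed
qed

inductive_cases typing_AppE: "E \<turnstile> App s t : T"
inductive_cases typing_LamE: "E \<turnstile> Lam S t : T"

lemma typing_unique: "E \<turnstile> t : T \<Longrightarrow> E \<turnstile> t : T' \<Longrightarrow> T = T'"
proof (induction arbitrary: T' rule: typing.induct)
  case (Var E i T)
  from Var.prems Var.hyps show ?case by (cases rule: typing.cases) auto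
next
  case (App E s S T t)
  from App.prems obtain S' where "E \<turnstile> s : S' \<rightarrow> T'" by (rule typing_AppE)
  from App.IH(1)[OF this] show ?case by simp
next
  case (Lam S E t T)
  from Lam.prems obtain T'' where "T' = S \<rightarrow> T''" "case_nat (Some S) E \<turnstile> t : T''"
    by (rule typing_LamE)
  with Lam.IH show ?case by simp
qed

lemma lr_beta_eta:
  "beta_eta s t \<Longrightarrow> E \<turnstile> s : T \<Longrightarrow> E \<turnstile> t : T \<Longrightarrow>
   (\<And>i S. E i = Some S \<Longrightarrow> lr S (e i) (e' i)) \<Longrightarrow> lr T (Clo s e) (Clo t e')"
proof (induction arbitrary: E T e e' rule: beta_eta.induct)
  case (beta S s t)
  have ee: "lr V (e' i) (e' i)" if "E i = Some V" for i V
    using beta.prems(3)[OF that] lr_sym lr_trans by blast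
  obtain s1: "case_nat (Some S) E \<turnstile> s : T" and t1: "E \<turnstile> t : S"
    using beta.prems(1) by (auto elim!: typing_AppE typing_LamE)
  have "lr T (Clo (subst s t 0) e') (Clo s (case_nat (Clo t e) e))"
  proof (rule lr_subst[OF s1 t1])
    show "lr V (if i < 0 then e' i else if i = 0 then Clo t e' else e' (i - 1))
        (case_nat (Clo t e) e i)" if "case_nat (Some S) E i = Some V" for i V
      using that ee lr_sym[OF beta.prems(3)] lr_sym[OF lr_typing[OF t1 beta.prems(3)]]
      by (cases i) auto
  qed (auto simp: ee)
  then have 1: "lr T (Clo s (case_nat (Clo t e) e)) (Clo (subst s t 0) e')" by (rule lr_sym)
  show ?case
    by (rule lr_wh_left[OF wh_App], rule lr_wh_left[OF wh_Lam], rule 1)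
next
  case (eta S s)
  from eta.prems(1) obtain T' where T: "T = S \<rightarrow> T'"
    by (auto elim!: typing_LamE)
  show ?case unfolding T lr.simps
  proof (intro allI impI)
    fix u u' assume u: "lr S u u'"
    have "lr (S \<rightarrow> T') (Clo (lift s 0) (case_nat u e)) (Clo s e')"
      by (rule lr_lift[OF eta.prems(2)[unfolded T]]) (use eta.prems(3) in auto)
    moreover have "lr S (Clo (Var 0) (case_nat u e)) u'"
      using u lr_wh_left[OF wh_Var[of 0 "case_nat u e"]] by simp
    ultimately have "lr T' (Ap (Clo (lift s 0) (case_nat u e)) (Clo (Var 0) (case_nat u e)))
        (Ap (Clo s e') u')" by simp
    then show "lr T' (Ap (Clo (Lam S (App (lift s 0) (Var 0))) e) u) (Ap (Clo s e') u')"
      by (rule lr_wh_left[OF wh_Lam lr_wh_left[OF wh_App]])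
  qed
next
  case (appL s s' t)
  obtain S where S: "E \<turnstile> s : S \<rightarrow> T" "E \<turnstile> t : S"
    using appL.prems(1) by (rule typing_AppE)
  obtain S' where "E \<turnstile> s' : S' \<rightarrow> T" "E \<turnstile> t : S'"
    using appL.prems(2) by (rule typing_AppE)
  \<comment> \<open>The common argument \<open>t\<close> has only one type, so both functions have
    the same domain.\<close>
  then have S': "E \<turnstile> s' : S \<rightarrow> T" using typing_unique[OF S(2)] by simp
  have "lr T (Ap (Clo s e) (Clo t e)) (Ap (Clo s' e') (Clo t e'))"
    using appL.IH[OF S(1) S'] lr_typing[OF S(2), of e e'] appL.prems(3) by simp
  then show ?case by (rule lr_wh[OF wh_App wh_App])
next
  case (appR t t' s)
  obtain S where S: "E \<turnstile> s : S \<rightarrow> T" "E \<turnstile> t : S"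
    using appR.prems(1) by (rule typing_AppE)
  obtain S' where "E \<turnstile> s : S' \<rightarrow> T" "E \<turnstile> t' : S'"
    using appR.prems(2) by (rule typing_AppE)
  then have S': "E \<turnstile> t' : S" using typing_unique[OF S(1)] by fastforce
  have "lr T (Ap (Clo s e) (Clo t e)) (Ap (Clo s e') (Clo t' e'))"
    using appR.IH[OF S(2) S'] lr_typing[OF S(1), of e e'] appR.prems(3) by simp
  then show ?case by (rule lr_wh[OF wh_App wh_App])
next
  case (lam t t' S)
  from lam.prems(1,2) obtain T' where T: "T = S \<rightarrow> T'" "case_nat (Some S) E \<turnstile> t : T'"
      "case_nat (Some S) E \<turnstile> t' : T'"
    by (auto elim!: typing_LamE)
  show ?case unfolding T lr.simps
  proof (intro allI impI)
    fix u u' assume u: "lr S u u'"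
    have "lr T' (Clo t (case_nat u e)) (Clo t' (case_nat u' e'))"
      by (rule lam.IH[OF T(2,3)]) (use u lam.prems(3) in \<open>auto split: nat.splits\<close>)
    then show "lr T' (Ap (Clo (Lam S t) e) u) (Ap (Clo (Lam S t') e') u')"
      by (rule lr_wh[OF wh_Lam wh_Lam])
  qed
qed

text \<open>The typed conversion chain supplies the typings for each step; \<open>lr_sym\<close>
  handles the backward steps.\<close>

lemma lr_beta_eta_eq:
  assumes "E \<turnstile> s =\<^sub>\<beta>\<^sub>\<eta> t : T" and e: "\<And>i S. E i = Some S \<Longrightarrow> lr S (e i) (e i)"
  shows "lr T (Clo s e) (Clo t e)"
proof -
  have s: "E \<turnstile> s : T"
    and "equivclp (\<lambda>u v. E \<turnstile> u : T \<and> E \<turnstile> v : T \<and> beta_eta u v) s t"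
    using assms(1) by (auto simp: beta_eta_eq_def)
  from this(2) show ?thesis
  proof (induction rule: equivclp_induct)
    case base
    show ?case using lr_typing[OF s] e by blast
  next
    case (step y z)
    then have "lr T (Clo y e) (Clo z e)"
      using lr_beta_eta[of y z E T e e] lr_beta_eta[of z y E T e e, THEN lr_sym] e by blast
    with step.IH show ?case by (rule lr_trans)
  qed
qed

lemma typing_cong_FV:
  "E \<turnstile> t : T \<Longrightarrow> (\<And>i. i \<in> FV t \<Longrightarrow> E i = E' i) \<Longrightarrow> E' \<turnstile> t : T"
proof (induction arbitrary: E' rule: typing.induct)
  case (Lam S E t T)
  have "case_nat (Some S) E' \<turnstile> t : T"
    by (rule Lam.IH) (use Lam.prems in \<open>auto split: nat.splits\<close>)
  then show ?case by (rule typing.Lam)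
next
  case (App E s S T t)
  show ?case by (rule typing.App[OF App.IH]) (use App.prems in auto)
qed (auto intro: typing.Var)

text \<open>This leads from \<open>alg\<close> back to \<open>lr\<close> for terms with finitely
  many names: the normal form is re-evaluated with related values for its variables.\<close>

lemma lr_sub:
  "alg \<sigma> t t' \<Longrightarrow> finite (names t) \<Longrightarrow> finite (names t') \<Longrightarrow>
   (\<And>n T. lr T (\<theta> n T) (\<theta>' n T)) \<Longrightarrow> lr \<sigma> (sub \<theta> t) (sub \<theta>' t')"
proof (induction arbitrary: \<theta> \<theta>' rule: alg.induct)
  case (alg_Atom s n T ms t ms' b)
  have fin: "finite (names m)" if "m \<in> set ms \<union> set ms'" for m
  proof (rule finite_subset)
    show "names m \<subseteq> names s \<union> names t"
      using that names_whs[OF alg_Atom.hyps(1)] names_whs[OF alg_Atom.hyps(2)]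
      by (auto simp: names_foldl_Ap)
  qed (use alg_Atom.prems in simp)
  have "lr (Atom (target T)) (foldl Ap (\<theta> n T) (map (sub \<theta>) ms)) (foldl Ap (\<theta>' n T) (map (sub \<theta>') ms'))"
    by (rule lr_foldl_Ap) (use alg_Atom fin in auto)
  with lr_whs[OF whs_sub[OF alg_Atom.hyps(1)] whs_sub[OF alg_Atom.hyps(2)], of "Atom b" \<theta> \<theta>']
  show ?case by (simp add: sub_foldl_Ap alg_Atom.hyps(3))
next
  case (alg_Fun \<tau> s \<sigma> t)
  show ?case unfolding lr.simps
  proof (intro allI impI)
    fix u u' assume u: "lr \<sigma> u u'"
    obtain n where n: "n \<notin> names s \<union> names t"
      using ex_new_if_finite[of "names s \<union> names t"] alg_Fun.prems by auto
    \<comment> \<open>The fresh name carries the argument. Only its entry at type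
      \<open>\<sigma>\<close> changes, since \<open>u\<close> and \<open>u'\<close> are related at
      that type.\<close>
    let ?f = "\<theta>(n := (\<theta> n)(\<sigma> := u))" and ?g = "\<theta>'(n := (\<theta>' n)(\<sigma> := u'))"
    have "lr \<tau> (sub ?f (Ap s (Fr n \<sigma>))) (sub ?g (Ap t (Fr n \<sigma>)))"
      by (rule alg_Fun.IH) (use alg_Fun.prems u in auto)
    moreover have "sub ?f s = sub \<theta> s" "sub ?g t = sub \<theta>' t"
      using n by (auto intro!: sub_cong)
    ultimately show "lr \<tau> (Ap (sub \<theta> s) u) (Ap (sub \<theta>' t) u')" by simp
  qed
qed

section \<open>Retractions with several coders\<close>

text \<open>\<open>\<theta>\<close> assigns the coders to the free variables of the decoder \<open>d\<close>; a variable whose type is not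
  in \<open>\<Theta>\<close> can only be renamed, so \<open>x\<close> enters through coders of types in \<open>\<Theta>\<close> only. The set \<open>A\<close> leaves
  infinitely many names fresh.\<close>

definition retr :: "'a ty \<Rightarrow> 'a ty set \<Rightarrow> bool" where
  "retr \<rho> \<Theta> \<longleftrightarrow> (\<exists>d \<theta> x A. alg \<rho> d d \<and> finite (names d) \<and> finite A \<and>
     (\<forall>n T. names (\<theta> n T) \<subseteq> A \<and> lr T (\<theta> n T) (\<theta> n T) \<and>
       (T \<in> \<Theta> \<or> (\<exists>n' T'. \<theta> n T = Fr n' T' \<and> (n', T') \<noteq> (x, \<rho>)))) \<and>
     alg \<rho> (sub \<theta> d) (Fr x \<rho>))"

lemma retract_retr:
  assumes "\<rho> \<unlhd> \<tau>"
  shows "retr \<rho> {\<tau>}"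
proof -
  from assms obtain E x C D where C: "E(x \<mapsto> \<rho>) \<turnstile> C : \<tau>" and D: "E \<turnstile> D : \<tau> \<rightarrow> \<rho>"
    and x: "x \<notin> FV D" and eq: "E(x \<mapsto> \<rho>) \<turnstile> App D C =\<^sub>\<beta>\<^sub>\<eta> Var x : \<rho>"
    unfolding retract_def by blast
  \<comment> \<open>Name 0 stands for \<open>x\<close>, 1 for all other variables and 2 for the
    place of the coder. The value of \<open>the (E i)\<close> matters only where \<open>E i\<close>
    is defined.\<close>
  define e1 where "e1 = (\<lambda>i. Fr 1 (the (E i)))"
  define e0 where "e0 = e1(x := Fr 0 \<rho>)"
  define d where "d = Ap (Clo D e1) (Fr 2 \<tau>)"
  \<comment> \<open>All variables but the coder's collapse to name 1. This bounds the names by 0 and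
    1, and keeps name 0 out of everything but the coder.\<close>
  define \<theta> where "\<theta> n T = (if n = 2 \<and> T = \<tau> then Clo C e0 else Fr 1 T)" for n :: nat and T
  have e1: "lr S (e1 i) (e1 i)" if "E i = Some S" for i S
    using that lr_Fr by (simp add: e1_def)
  have e0: "lr S (e0 i) (e0 i)" if "(E(x \<mapsto> \<rho>)) i = Some S" for i S
    using that lr_Fr by (auto simp: e0_def e1_def split: if_splits)
  have C0: "lr \<tau> (Clo C e0) (Clo C e0)" by (rule lr_typing[OF C e0])
  have "lr (\<tau> \<rightarrow> \<rho>) (Clo D e1) (Clo D e1)" by (rule lr_typing[OF D e1])
  then have d: "lr \<rho> d d" using lr_Fr[of \<tau> 2] by (simp add: d_def)
  \<comment> \<open>Without \<open>x\<close> in its domain, the environment no longer distinguishes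
    \<open>e0\<close> from \<open>e1\<close>.\<close>
  have "E(x := None) \<turnstile> D : \<tau> \<rightarrow> \<rho>" by (rule typing_cong_FV[OF D]) (use x in auto)
  then have "lr (\<tau> \<rightarrow> \<rho>) (Clo D e1) (Clo D e0)"
    by (rule lr_typing) (auto simp: e0_def e1 split: if_splits)
  with C0 have 1: "lr \<rho> (Ap (Clo D e1) (Clo C e0)) (Ap (Clo D e0) (Clo C e0))" by simp
  have "lr \<rho> (Clo (App D C) e0) (Clo (Var x) e0)" by (rule lr_beta_eta_eq[OF eq e0])
  moreover have "lr \<rho> (Ap (Clo D e0) (Clo C e0)) (Clo (App D C) e0)"
    by (rule lr_sym[OF lr_wh_left[OF wh_App lr_trans[OF lr_sym[OF 1] 1]]])
  moreover have "lr \<rho> (Clo (Var x) e0) (Fr 0 \<rho>)"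
    by (rule lr_wh_left[OF wh_Var]) (simp add: e0_def lr_Fr)
  ultimately have "lr \<rho> (Ap (Clo D e1) (Clo C e0)) (Fr 0 \<rho>)"
    using lr_trans[OF lr_trans[OF 1 lr_trans]] by blast
  moreover have "sub \<theta> d = Ap (Clo D e1) (Clo C e0)"
    by (simp add: d_def \<theta>_def e1_def)
  ultimately have "alg \<rho> (sub \<theta> d) (Fr 0 \<rho>)" by (simp add: lr_alg)
  moreover have "finite (names d)" by (simp add: d_def e1_def)
  moreover have "names (\<theta> n T) \<subseteq> {0, 1}" for n T
    by (auto simp: \<theta>_def e0_def e1_def split: if_splits)
  moreover have "lr T (\<theta> n T) (\<theta> n T)" for n T
    using C0 lr_Fr by (auto simp: \<theta>_def)
  moreover have "T \<in> {\<tau>} \<or> (\<exists>n' T'. \<theta> n T = Fr n' T' \<and> (n', T') \<noteq> (0, \<rho>))" for n T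
    by (auto simp: \<theta>_def)
  ultimately show ?thesis
    unfolding retr_def
    by (intro exI[of _ d] exI[of _ \<theta>] exI[of _ "0::nat"] exI[of _ "{0, 1::nat}"])
      (auto simp: lr_alg[OF d])
qed

section \<open>One step along a path\<close>

text \<open>The logical predicate generated at atoms by: if \<open>s\<close> head-reduces to \<open>x M\<^sub>1 \<dots> M\<^sub>m\<close> with \<open>M\<^sub>j = z\<^sub>j\<close>
  for all \<open>j\<close>, then \<open>\<Phi>\<close>. All \<open>z\<^sub>j\<close> share the name \<open>z\<close>: it only matters that they differ from \<open>x\<close>.
  The predicate holds trivially at targets other than that of \<open>\<rho>\<close>, which confines the proof
  about coders to the nodes labelled by this target.\<close>

primrec tame :: "nat \<Rightarrow> 'a ty \<Rightarrow> nat \<Rightarrow> bool \<Rightarrow> 'a ty \<Rightarrow> 'a cl \<Rightarrow> bool" where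
  "tame x \<rho> z \<Phi> (Atom b) = (\<lambda>s. b = target \<rho> \<longrightarrow> (\<forall>ms. wh\<^sup>*\<^sup>* s (spine x \<rho> ms) \<longrightarrow>
     length ms = length (arg_tys \<rho>) \<longrightarrow>
     (\<forall>i<length (arg_tys \<rho>). alg (arg_tys \<rho> ! i) (ms ! i) (Fr z (arg_tys \<rho> ! i))) \<longrightarrow> \<Phi>))"
| "tame x \<rho> z \<Phi> (\<sigma> \<rightarrow> \<tau>) = (\<lambda>s. \<forall>u. lr \<sigma> u u \<longrightarrow> finite (names u) \<longrightarrow> tame x \<rho> z \<Phi> \<sigma> u \<longrightarrow>
     tame x \<rho> z \<Phi> \<tau> (Ap s u))"

lemma tame_target: "target \<sigma> \<noteq> target \<rho> \<Longrightarrow> tame x \<rho> z \<Phi> \<sigma> s"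
  by (induction \<sigma> arbitrary: s) auto

text \<open>A spine is weak head normal, so its head remains different from \<open>x\<close> under
  any further arguments.\<close>

lemma tame_spine: "(n, T) \<noteq> (x, \<rho>) \<Longrightarrow> tame x \<rho> z \<Phi> \<sigma> (spine n T ms)"
proof (induction \<sigma> arbitrary: ms)
  case (Atom b)
  then have "\<not> wh\<^sup>*\<^sup>* (spine n T ms) (spine x \<rho> ms')" for ms'
    using whs_spine spine_inject by (metis)
  then show ?case by simp
next
  case (Fun \<sigma> \<tau>)
  show ?case unfolding tame.simps
  proof (intro allI impI)
    fix u
    show "tame x \<rho> z \<Phi> \<tau> (Ap (spine n T ms) u)"
      using Fun.IH(2)[OF Fun.prems, of "ms @ [u]"] by simp
  qed
qed

lemma tame_whs: "wh\<^sup>*\<^sup>* s s' \<Longrightarrow> tame x \<rho> z \<Phi> (Atom b) s' \<Longrightarrow> tame x \<rho> z \<Phi> (Atom b) s"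
  using whs_to_spine[of s s' x \<rho>] by auto

lemma tame_foldl_Ap:
  "tame x \<rho> z \<Phi> T f \<Longrightarrow> length ms = length (arg_tys T) \<Longrightarrow>
   (\<And>i. i < length (arg_tys T) \<Longrightarrow> lr (arg_tys T ! i) (ms ! i) (ms ! i) \<and> finite (names (ms ! i)) \<and>
     tame x \<rho> z \<Phi> (arg_tys T ! i) (ms ! i)) \<Longrightarrow>
   tame x \<rho> z \<Phi> (Atom (target T)) (foldl Ap f ms)"
proof (induction T arbitrary: f ms)
  case (Fun \<sigma> \<tau>)
  obtain m ns where ms: "ms = m # ns" using Fun.prems(2) by (cases ms) auto
  have "tame x \<rho> z \<Phi> \<tau> (Ap f m)"
    using Fun.prems(1) Fun.prems(3)[of 0] ms by simp
  then have "tame x \<rho> z \<Phi> (Atom (target \<tau>)) (foldl Ap (Ap f m) ns)"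
  proof (rule Fun.IH(2))
    show "lr (arg_tys \<tau> ! i) (ns ! i) (ns ! i) \<and> finite (names (ns ! i)) \<and>
        tame x \<rho> z \<Phi> (arg_tys \<tau> ! i) (ns ! i)" if "i < length (arg_tys \<tau>)" for i
      using Fun.prems(3)[of "Suc i"] that ms by simp
  qed (use Fun.prems(2) ms in simp)
  then show ?case using ms by simp
qed simp

lemma finite_names_args:
  assumes "wh\<^sup>*\<^sup>* t (spine n T ms)" and "finite (names t)" and "i < length ms"
  shows "finite (names (ms ! i))"
proof (rule finite_subset[OF _ assms(2)])
  have "names (ms ! i) \<subseteq> names (spine n T ms)"
    using assms(3) by (auto simp: names_foldl_Ap)
  with names_whs[OF assms(1)] show "names (ms ! i) \<subseteq> names t" by simp
qed

text \<open>Fundamental lemma for \<open>tame\<close>, by induction on the normal form recorded in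
  \<open>alg\<close>: it suffices that all values put in for the variables are tame.\<close>

lemma tame_decoder:
  "alg \<sigma> t t' \<Longrightarrow> finite (names t) \<Longrightarrow> finite (names t') \<Longrightarrow> finite A \<Longrightarrow>
   (\<And>n T. names (\<theta> n T) \<subseteq> A \<and> lr T (\<theta> n T) (\<theta> n T) \<and> tame x \<rho> z \<Phi> T (\<theta> n T)) \<Longrightarrow>
   tame x \<rho> z \<Phi> \<sigma> (sub \<theta> t)"
proof (induction arbitrary: \<theta> A rule: alg.induct)
  case (alg_Atom s n T ms t ms' b)
  note fin = finite_names_args[OF alg_Atom.hyps(1) alg_Atom.prems(1)]
    finite_names_args[OF alg_Atom.hyps(2) alg_Atom.prems(2)]
  have "tame x \<rho> z \<Phi> (Atom (target T)) (foldl Ap (\<theta> n T) (map (sub \<theta>) ms))"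
  proof (rule tame_foldl_Ap)
    show "tame x \<rho> z \<Phi> T (\<theta> n T)" using alg_Atom.prems(4) by blast
    fix i assume i: "i < length (arg_tys T)"
    have a: "alg (arg_tys T ! i) (ms ! i) (ms ! i)"
      using alg_Atom.hyps(6)[OF i] alg_sym alg_trans by blast
    have "lr (arg_tys T ! i) (sub \<theta> (ms ! i)) (sub \<theta> (ms ! i))"
      by (rule lr_sub[OF a]) (use fin i alg_Atom in auto)
    moreover have "finite (names (sub \<theta> (ms ! i)))"
      by (rule finite_subset[OF names_sub alg_Atom.prems(3)]) (use alg_Atom.prems(4) in blast)
    moreover have "tame x \<rho> z \<Phi> (arg_tys T ! i) (sub \<theta> (ms ! i))"
      by (rule alg_Atom.IH[OF i _ _ alg_Atom.prems(3,4)]) (use fin i alg_Atom.hyps in auto)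
    ultimately show "lr (arg_tys T ! i) (map (sub \<theta>) ms ! i) (map (sub \<theta>) ms ! i) \<and>
        finite (names (map (sub \<theta>) ms ! i)) \<and> tame x \<rho> z \<Phi> (arg_tys T ! i) (map (sub \<theta>) ms ! i)"
      using i alg_Atom.hyps by simp
  qed (use alg_Atom.hyps in simp)
  then show ?case
    using tame_whs[OF whs_sub[OF alg_Atom.hyps(1)]] alg_Atom.hyps(3) by (simp only: sub_foldl_Ap sub.simps)
next
  case (alg_Fun \<tau> s \<sigma> t)
  show ?case unfolding tame.simps
  proof (intro allI impI)
    fix u assume u: "lr \<sigma> u u" "finite (names u)" "tame x \<rho> z \<Phi> \<sigma> u"
    obtain n where n: "n \<notin> names s"
      using ex_new_if_finite[of "names s"] alg_Fun.prems(1) by auto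
    let ?f = "\<theta>(n := (\<theta> n)(\<sigma> := u))"
    have f: "names (?f m T) \<subseteq> A \<union> names u \<and> lr T (?f m T) (?f m T) \<and> tame x \<rho> z \<Phi> T (?f m T)" for m T
      using alg_Fun.prems(4)[of m T] u by auto
    have "tame x \<rho> z \<Phi> \<tau> (sub ?f (Ap s (Fr n \<sigma>)))"
      by (rule alg_Fun.IH[OF _ _ _ f]) (use alg_Fun.prems u in auto)
    moreover have "sub ?f s = sub \<theta> s" using n by (auto intro!: sub_cong)
    ultimately show "tame x \<rho> z \<Phi> \<tau> (Ap (sub \<theta> s) u)" by simp
  qed
qed

text \<open>\<open>x\<close> itself is not tame, so it must be kept apart from the bound variables of the coder;
  when it is reached as a head, its arguments are the new decoders.\<close>

lemma tame_coder:
  assumes "x \<noteq> z"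
    and closed: "\<And>T S. T \<in> N \<Longrightarrow> target T = target \<rho> \<Longrightarrow> S \<in> set (arg_tys T) \<Longrightarrow>
      target S = target \<rho> \<Longrightarrow> set (arg_tys S) \<subseteq> N"
    and \<Phi>: "(\<And>i. i < length (arg_tys \<rho>) \<Longrightarrow> retr (arg_tys \<rho> ! i) N) \<Longrightarrow> \<Phi>"
  shows "alg \<sigma> t t' \<Longrightarrow> finite (names t) \<Longrightarrow> finite (names t') \<Longrightarrow>
    (target \<sigma> = target \<rho> \<Longrightarrow> set (arg_tys \<sigma>) \<subseteq> N) \<Longrightarrow> finite A \<Longrightarrow> \<theta> x \<rho> = Fr x \<rho> \<Longrightarrow>
    (\<And>n T. names (\<theta> n T) \<subseteq> A \<and> lr T (\<theta> n T) (\<theta> n T)) \<Longrightarrow>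
    (\<And>n T. (n, T) \<noteq> (x, \<rho>) \<Longrightarrow> T \<in> N \<and> tame x \<rho> z \<Phi> T (\<theta> n T) \<or>
      (\<exists>n' T'. \<theta> n T = Fr n' T' \<and> n' \<noteq> z \<and> (n', T') \<noteq> (x, \<rho>))) \<Longrightarrow>
    tame x \<rho> z \<Phi> \<sigma> (sub \<theta> t)"
proof (induction arbitrary: \<theta> A rule: alg.induct)
  case (alg_Atom s n T ms t ms' b)
  note fin = finite_names_args[OF alg_Atom.hyps(1) alg_Atom.prems(1)]
    finite_names_args[OF alg_Atom.hyps(2) alg_Atom.prems(2)]
  note \<theta> = alg_Atom.prems(5-7)
  have a: "alg (arg_tys T ! i) (ms ! i) (ms ! i)" if "i < length (arg_tys T)" for i
    using alg_Atom.hyps(6)[OF that] alg_sym alg_trans by blast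
  show ?case
  proof (cases "b = target \<rho>")
    case False
    then show ?thesis by (simp add: tame_target)
  next
    case b: True
    have "tame x \<rho> z \<Phi> (Atom b) (foldl Ap (\<theta> n T) (map (sub \<theta>) ms))"
    proof (cases "(n, T) = (x, \<rho>)")
      case True
      then have nT: "n = x" "T = \<rho>" by auto
      show ?thesis
        unfolding tame.simps nT \<theta>(1)
      proof (intro impI allI)
        fix ks
        assume wh: "wh\<^sup>*\<^sup>* (spine x \<rho> (map (sub \<theta>) ms)) (spine x \<rho> ks)"
          and al: "\<forall>i<length (arg_tys \<rho>). alg (arg_tys \<rho> ! i) (ks ! i) (Fr z (arg_tys \<rho> ! i))"
        have ks: "ks = map (sub \<theta>) ms"
          using whs_spine[OF wh] unfolding spine_inject by simp
        \<comment> \<open>The head is \<open>x\<close>, and its arguments equal \<open>z\<close>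
          after substitution. So each \<open>ms ! i\<close> is a decoder for \<open>z\<close> with
          the coders \<open>\<theta>\<close>.\<close>
        show \<Phi>
        proof (rule \<Phi>)
          fix i assume i: "i < length (arg_tys \<rho>)"
          have var: "T \<in> N \<or> (\<exists>n' T'. \<theta> n T = Fr n' T' \<and> (n', T') \<noteq> (z, arg_tys \<rho> ! i))" for n T
            using \<theta>(1) \<theta>(3)[of n T] \<open>x \<noteq> z\<close> by (cases "(n, T) = (x, \<rho>)") auto
          have "alg (arg_tys \<rho> ! i) (sub \<theta> (ms ! i)) (Fr z (arg_tys \<rho> ! i))"
            using al i ks nT alg_Atom.hyps(4) by auto
          moreover have "finite (names (ms ! i))" using fin(1) i nT alg_Atom.hyps(4) by simp
          ultimately show "retr (arg_tys \<rho> ! i) N"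
            unfolding retr_def using a i nT \<theta>(2) var alg_Atom.prems(4)
            by (intro exI[of _ "ms ! i"] exI[of _ \<theta>] exI[of _ z] exI[of _ A]) simp
        qed
      qed
    next
      case nT: False
      from \<theta>(3)[OF nT] show ?thesis
      proof (elim disjE conjE exE)
        fix n' T' assume "\<theta> n T = Fr n' T'" "(n', T') \<noteq> (x, \<rho>)"
        then show ?thesis by (simp only: tame_spine not_False_eq_True)
      next
        assume N: "T \<in> N" and tame: "tame x \<rho> z \<Phi> T (\<theta> n T)"
        have "tame x \<rho> z \<Phi> (Atom (target T)) (foldl Ap (\<theta> n T) (map (sub \<theta>) ms))"
        proof (rule tame_foldl_Ap[OF tame])
          fix i assume i: "i < length (arg_tys T)"
          have "lr (arg_tys T ! i) (sub \<theta> (ms ! i)) (sub \<theta> (ms ! i))"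
            by (rule lr_sub[OF a[OF i]]) (use fin i alg_Atom.hyps(4) \<theta>(2) in auto)
          moreover have "finite (names (sub \<theta> (ms ! i)))"
            by (rule finite_subset[OF names_sub alg_Atom.prems(4)]) (use \<theta>(2) in blast)
          moreover have "tame x \<rho> z \<Phi> (arg_tys T ! i) (sub \<theta> (ms ! i))"
          proof (rule alg_Atom.IH[where \<theta> = \<theta> and A = A, OF i _ _ _ alg_Atom.prems(4) \<theta>])
            \<comment> \<open>The head is a bound variable. Its arguments with the right target bind
              variables that lie two levels further down, which \<open>closed\<close> keeps in
              \<open>N\<close>.\<close>
            show "set (arg_tys (arg_tys T ! i)) \<subseteq> N" if "target (arg_tys T ! i) = target \<rho>"
              using closed[OF N _ _ that] i b alg_Atom.hyps(3) by simp
          qed (use fin i alg_Atom.hyps(4,5) in auto)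
          ultimately show "lr (arg_tys T ! i) (map (sub \<theta>) ms ! i) (map (sub \<theta>) ms ! i) \<and>
              finite (names (map (sub \<theta>) ms ! i)) \<and>
              tame x \<rho> z \<Phi> (arg_tys T ! i) (map (sub \<theta>) ms ! i)"
            using i alg_Atom.hyps(4) by simp
        qed (use alg_Atom.hyps in simp)
        then show ?thesis using alg_Atom.hyps(3) by simp
      qed
    qed
    then show ?thesis
      using tame_whs[OF whs_sub[OF alg_Atom.hyps(1)]] by (simp only: sub_foldl_Ap sub.simps)
  qed
next
  case (alg_Fun \<tau> s \<sigma> t)
  show ?case
  proof (cases "target \<tau> = target \<rho>")
    case False
    then show ?thesis by (intro tame_target) simp
  next
    case True
    then have N: "\<sigma> \<in> N" "set (arg_tys \<tau>) \<subseteq> N" using alg_Fun.prems(3) by auto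
    show ?thesis unfolding tame.simps
    proof (intro allI impI)
      fix u assume u: "lr \<sigma> u u" "finite (names u)" "tame x \<rho> z \<Phi> \<sigma> u"
      \<comment> \<open>Avoiding \<open>x\<close> as well preserves
        \<open>\<theta> x \<rho> = Fr x \<rho>\<close>.\<close>
      obtain n where n: "n \<notin> insert x (names s)"
        using ex_new_if_finite[of "insert x (names s)"] alg_Fun.prems(1) by auto
      let ?f = "\<theta>(n := (\<theta> n)(\<sigma> := u))"
      have f: "names (?f m T) \<subseteq> A \<union> names u \<and> lr T (?f m T) (?f m T)" for m T
        using alg_Fun.prems(6)[of m T] u by auto
      have g: "T \<in> N \<and> tame x \<rho> z \<Phi> T (?f m T) \<or>
          (\<exists>n' T'. ?f m T = Fr n' T' \<and> n' \<noteq> z \<and> (n', T') \<noteq> (x, \<rho>))" if "(m, T) \<noteq> (x, \<rho>)" for m T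
        using alg_Fun.prems(7)[OF that] u(3) N(1) by (cases "m = n \<and> T = \<sigma>") auto
      have "tame x \<rho> z \<Phi> \<tau> (sub ?f (Ap s (Fr n \<sigma>)))"
        by (rule alg_Fun.IH[OF _ _ _ _ _ f g]) (use alg_Fun.prems u n N in auto)
      moreover have "sub ?f s = sub \<theta> s" using n by (auto intro!: sub_cong)
      ultimately show "tame x \<rho> z \<Phi> \<tau> (Ap (sub \<theta> s) u)" by simp
    qed
  qed
qed

text \<open>These are the types of the coder subterms that can lead to \<open>x\<close>. In
  \<open>step\<close>, \<open>\<sigma>\<close> is the type of a variable bound in such a subterm and
  \<open>\<sigma>'\<close> that of an argument of this variable.\<close>

inductive_set odd_nodes :: "'a \<Rightarrow> 'a ty set \<Rightarrow> 'a ty set" for a \<Theta> where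
  root: "\<tau> \<in> \<Theta> \<Longrightarrow> target \<tau> = a \<Longrightarrow> \<tau> \<in> odd_nodes a \<Theta>"
| step: "\<tau> \<in> odd_nodes a \<Theta> \<Longrightarrow> \<sigma> \<in> set (arg_tys \<tau>) \<Longrightarrow> target \<sigma> = a \<Longrightarrow>
    \<sigma>' \<in> set (arg_tys \<sigma>) \<Longrightarrow> target \<sigma>' = a \<Longrightarrow> \<sigma>' \<in> odd_nodes a \<Theta>"

definition children :: "'a ty set \<Rightarrow> 'a ty set" where
  "children \<Theta> = (\<Union>\<tau>\<in>\<Theta>. set (arg_tys \<tau>))"

text \<open>The claim itself serves as \<open>\<Phi>\<close> in \<open>tame\<close>: the decoder
  under its coders is tame, and applied to the variables named \<open>z\<close> it reaches the spine
  from which \<open>tame\<close> yields \<open>\<Phi>\<close>.\<close>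

lemma retr_step:
  assumes "retr \<rho> \<Theta>"
  shows "odd_nodes (target \<rho>) \<Theta> \<noteq> {} \<and>
    (\<forall>i<length (arg_tys \<rho>). retr (arg_tys \<rho> ! i) (children (odd_nodes (target \<rho>) \<Theta>)))"
    (is ?\<Phi>)
proof -
  let ?O = "odd_nodes (target \<rho>) \<Theta>"
  from assms obtain d \<theta> x A where d: "alg \<rho> d d" "finite (names d)" and A: "finite A"
    and \<theta>: "\<And>n T. names (\<theta> n T) \<subseteq> A" "\<And>n T. lr T (\<theta> n T) (\<theta> n T)"
      "\<And>n T. T \<in> \<Theta> \<or> (\<exists>n' T'. \<theta> n T = Fr n' T' \<and> (n', T') \<noteq> (x, \<rho>))"
    and al: "alg \<rho> (sub \<theta> d) (Fr x \<rho>)"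
    unfolding retr_def by blast
  obtain z where z: "z \<notin> insert x A" using ex_new_if_finite[of "insert x A"] A by auto
  obtain c where c: "c \<notin> {x, z}" using ex_new_if_finite[of "{x, z}"] by auto
  \<comment> \<open>\<open>\<eta>\<close> leaves the coders unchanged, as their names lie in
    \<open>A\<close>. It sends every other name except \<open>x\<close> to \<open>c\<close>, so that
    no variable is mapped to the name \<open>z\<close>.\<close>
  define \<eta> where "\<eta> n T = (if n \<in> insert x A then Fr n T else Fr c T)" for n and T :: "'a ty"
  have tame: "tame x \<rho> z ?\<Phi> T (\<theta> n T)" for n T
  proof (cases "T \<in> \<Theta>")
    case False
    then obtain n' T' where "\<theta> n T = Fr n' T'" "(n', T') \<noteq> (x, \<rho>)" using \<theta>(3) by blast
    then show ?thesis using tame_spine[of n' T' x \<rho> z ?\<Phi> T "[]"] by simp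
  next
    case T: True
    show ?thesis
    proof (cases "target T = target \<rho>")
      case False
      then show ?thesis by (rule tame_target)
    next
      case True
      then have O: "T \<in> ?O" using T by (intro odd_nodes.root)
      have fin: "finite (names (\<theta> n T))" using \<theta>(1) A by (rule finite_subset)
      have "tame x \<rho> z ?\<Phi> T (sub \<eta> (\<theta> n T))"
      proof (rule tame_coder[where N = "children ?O" and A = "insert c (insert x A)"])
        show "x \<noteq> z" using z by auto
        show "set (arg_tys S) \<subseteq> children ?O"
          if "U \<in> children ?O" "target U = target \<rho>" "S \<in> set (arg_tys U)" "target S = target \<rho>" for U S
        proof -
          from that(1) obtain V where "V \<in> ?O" "U \<in> set (arg_tys V)" by (auto simp: children_def)
          then have "S \<in> ?O" using that(2-4) by (rule odd_nodes.step)
          then show ?thesis by (auto simp: children_def)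
        qed
        show ?\<Phi> if "\<And>i. i < length (arg_tys \<rho>) \<Longrightarrow> retr (arg_tys \<rho> ! i) (children ?O)"
          using that O by blast
        show "alg T (\<theta> n T) (\<theta> n T)" using \<theta>(2) by (rule lr_alg)
        show "set (arg_tys T) \<subseteq> children ?O" using O by (auto simp: children_def)
        show "\<eta> x \<rho> = Fr x \<rho>" by (simp add: \<eta>_def)
        show "names (\<eta> m S) \<subseteq> insert c (insert x A) \<and> lr S (\<eta> m S) (\<eta> m S)" for m S
          by (auto simp: \<eta>_def lr_Fr)
        show "S \<in> children ?O \<and> tame x \<rho> z ?\<Phi> S (\<eta> m S) \<or>
            (\<exists>n' T'. \<eta> m S = Fr n' T' \<and> n' \<noteq> z \<and> (n', T') \<noteq> (x, \<rho>))" if "(m, S) \<noteq> (x, \<rho>)" for m S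
          using that z c by (auto simp: \<eta>_def)
      qed (use fin A in auto)
      moreover have "sub \<eta> (\<theta> n T) = \<theta> n T"
        by (rule sub_Fr) (use \<theta>(1) in \<open>auto simp: \<eta>_def\<close>)
      ultimately show ?thesis by simp
    qed
  qed
  have "tame x \<rho> z ?\<Phi> \<rho> (sub \<theta> d)"
    by (rule tame_decoder[OF d d(2) A]) (use \<theta> tame in blast)
  let ?zs = "map (Fr z) (arg_tys \<rho>)"
  have "tame x \<rho> z ?\<Phi> (Atom (target \<rho>)) (foldl Ap (sub \<theta> d) ?zs)"
  proof (rule tame_foldl_Ap)
    show "tame x \<rho> z ?\<Phi> \<rho> (sub \<theta> d)" by fact
    fix i assume i: "i < length (arg_tys \<rho>)"
    have "tame x \<rho> z ?\<Phi> (arg_tys \<rho> ! i) (Fr z (arg_tys \<rho> ! i))"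
      using tame_spine[of z "arg_tys \<rho> ! i" x \<rho> z ?\<Phi> "arg_tys \<rho> ! i" "[]"] z by simp
    then show "lr (arg_tys \<rho> ! i) (?zs ! i) (?zs ! i) \<and> finite (names (?zs ! i)) \<and>
        tame x \<rho> z ?\<Phi> (arg_tys \<rho> ! i) (?zs ! i)"
      using i lr_Fr by simp
  qed simp
  moreover
  \<comment> \<open>The right-hand side is already a spine with head \<open>x\<close>, so the
    left-hand side reduces to one as well, with arguments equal to the variables named
    \<open>z\<close>.\<close>
  from alg_foldl_Fr[OF al, of z] obtain n T ms ms' where
    ms: "wh\<^sup>*\<^sup>* (foldl Ap (sub \<theta> d) ?zs) (spine n T ms)" "wh\<^sup>*\<^sup>* (spine x \<rho> ?zs) (spine n T ms')"
      "length ms = length (arg_tys T)"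
      "\<And>i. i < length (arg_tys T) \<Longrightarrow> alg (arg_tys T ! i) (ms ! i) (ms' ! i)"
    by (elim alg_AtomE) blast
  have "n = x" "T = \<rho>" "ms' = ?zs"
    using whs_spine[OF ms(2)] unfolding spine_inject by simp_all
  then have "wh\<^sup>*\<^sup>* (foldl Ap (sub \<theta> d) ?zs) (spine x \<rho> ms)" "length ms = length (arg_tys \<rho>)"
    "\<forall>i<length (arg_tys \<rho>). alg (arg_tys \<rho> ! i) (ms ! i) (Fr z (arg_tys \<rho> ! i))"
    using ms by simp_all
  ultimately show ?\<Phi> unfolding tame.simps by blast
qed

section \<open>Paths\<close>

lemma word_le_append: "w \<sqsubseteq> v \<Longrightarrow> w @ u \<sqsubseteq> v @ u"
proof (induction rule: rtranclp_induct)
  case (step v v')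
  from step.hyps(2) have "v @ u \<sqsubseteq>\<^sup>0 v' @ u"
    by cases (metis append.assoc word_le0.intros)
  with step.IH show ?case by (rule rtranclp.rtrancl_into_rtrancl)
qed simp

lemma word_le_length: "w \<sqsubseteq> v \<Longrightarrow> length w \<le> length v"
  by (induction rule: rtranclp_induct) (auto elim!: word_le0.cases)

definition path_words :: "'a ty \<Rightarrow> 'a list set" where
  "path_words \<tau> = {path_word (tree_of \<tau>) \<pi> |\<pi>. is_path \<pi> (tree_of \<tau>)}"

lemma path_words_root: "[target \<tau>] \<in> path_words \<tau>"
  unfolding path_words_def by (subst (1 2) tree_of.simps) (auto intro!: exI[of _ "[]"])

lemma path_words_child:
  assumes "\<sigma> \<in> set (arg_tys \<tau>)" and "w \<in> path_words \<sigma>"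
  shows "w @ [target \<tau>] \<in> path_words \<tau>"
proof -
  obtain i where i: "i < length (arg_tys \<tau>)" "\<sigma> = arg_tys \<tau> ! i"
    using assms(1) by (metis in_set_conv_nth)
  obtain \<pi> where "w = path_word (tree_of \<sigma>) \<pi>" "is_path \<pi> (tree_of \<sigma>)"
    using assms(2) unfolding path_words_def by blast
  with i have "w @ [target \<tau>] = path_word (tree_of \<tau>) (i # \<pi>)" "is_path (i # \<pi>) (tree_of \<tau>)"
    by (simp_all add: tree_of.simps[of \<tau>])
  then show ?thesis unfolding path_words_def by blast
qed

text \<open>Each descent by two levels appends \<open>aa\<close> to the word, and this is absorbed
  by tripling the final \<open>a\<close> of \<open>w @ [a]\<close>. Hence \<open>w\<close> must vary
  in the induction.\<close>

lemma odd_nodes_path: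
  "\<tau>' \<in> odd_nodes a \<Theta> \<Longrightarrow> w @ [a] \<sqsubseteq> v \<Longrightarrow> v \<in> path_words \<tau>' \<Longrightarrow>
   \<exists>\<tau>\<in>\<Theta>. \<exists>v\<in>path_words \<tau>. w @ [a] \<sqsubseteq> v"
proof (induction arbitrary: v w rule: odd_nodes.induct)
  case (root \<tau>)
  then show ?case by blast
next
  case (step \<tau> \<sigma> \<sigma>')
  have "v @ [a] \<in> path_words \<sigma>"
    using path_words_child[OF step.hyps(4) step.prems(2)] step.hyps(3) by simp
  moreover have "target \<tau> = a"
    using step.hyps(1) by cases auto
  ultimately have "v @ [a, a] \<in> path_words \<tau>"
    using path_words_child[OF step.hyps(2)] by fastforce
  moreover have "(w @ [a, a]) @ [a] \<sqsubseteq> v @ [a, a]"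
    using word_le_append[OF step.prems(1), of "[a, a]"] by simp
  ultimately obtain \<tau>0 v0 where "\<tau>0 \<in> \<Theta>" "v0 \<in> path_words \<tau>0" "(w @ [a, a]) @ [a] \<sqsubseteq> v0"
    using step.IH by blast
  moreover have "w @ [a] \<sqsubseteq>\<^sup>0 (w @ [a, a]) @ [a]"
    using word_le0.intros[of w a "[]"] by simp
  ultimately show ?case by (meson converse_rtranclp_into_rtranclp)
qed

text \<open>Each letter of the path uses \<open>retr_step\<close> once, so \<open>\<Theta>\<close>
  varies. At the end of the path, a nonempty set of odd nodes provides the last letter.\<close>

lemma retr_path:
  "is_path \<pi> (tree_of \<rho>) \<Longrightarrow> retr \<rho> \<Theta> \<Longrightarrow>
   \<exists>\<tau>\<in>\<Theta>. \<exists>v\<in>path_words \<tau>. path_word (tree_of \<rho>) \<pi> \<sqsubseteq> v"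
proof (induction \<pi> arbitrary: \<rho> \<Theta>)
  case Nil
  from retr_step[OF Nil.prems(2)] obtain \<tau> where \<tau>: "\<tau> \<in> odd_nodes (target \<rho>) \<Theta>" by blast
  then have "target \<tau> = target \<rho>" by cases auto
  then have "[target \<rho>] \<in> path_words \<tau>" using path_words_root by metis
  with odd_nodes_path[OF \<tau>, of "[]" "[target \<rho>]"] show ?case
    by (simp add: tree_of.simps[of \<rho>])
next
  case (Cons i \<pi>)
  have i: "i < length (arg_tys \<rho>)" "is_path \<pi> (tree_of (arg_tys \<rho> ! i))"
    using Cons.prems(1) by (auto simp: tree_of.simps[of \<rho>])
  let ?w = "path_word (tree_of (arg_tys \<rho> ! i)) \<pi>"
  have "retr (arg_tys \<rho> ! i) (children (odd_nodes (target \<rho>) \<Theta>))"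
    using retr_step[OF Cons.prems(2)] i(1) by blast
  from Cons.IH[OF i(2) this] obtain \<tau> \<sigma> v where \<tau>: "\<tau> \<in> odd_nodes (target \<rho>) \<Theta>"
    and \<sigma>: "\<sigma> \<in> set (arg_tys \<tau>)" and v: "v \<in> path_words \<sigma>" "?w \<sqsubseteq> v"
    unfolding children_def by blast
  have "target \<tau> = target \<rho>" using \<tau> by cases auto
  with path_words_child[OF \<sigma> v(1)] have "v @ [target \<rho>] \<in> path_words \<tau>" by simp
  with odd_nodes_path[OF \<tau> word_le_append[OF v(2)]] show ?case
    using i(1) by (simp add: tree_of.simps[of \<rho>])
qed

text \<open>With \<open>path_length_le_rank\<close>, this makes \<open>Suc (rank \<tau>)\<close> the
  maximal number of nodes on a path, which reduces the rank bound to the statement on paths.\<close>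

lemma rank_path: "\<exists>w\<in>path_words \<tau>. length w = Suc (rank \<tau>)"
proof (induction \<tau> rule: rank.induct)
  case (1 \<tau>)
  show ?case
  proof (cases "arg_tys \<tau> = []")
    case True
    then show ?thesis using path_words_root[of \<tau>] by (intro bexI) (auto simp: rank.simps[of \<tau>])
  next
    case False
    then have "Max (rank ` set (arg_tys \<tau>)) \<in> rank ` set (arg_tys \<tau>)" by (intro Max_in) auto
    then obtain \<sigma> where \<sigma>: "\<sigma> \<in> set (arg_tys \<tau>)" "Max (rank ` set (arg_tys \<tau>)) = rank \<sigma>" by auto
    with 1 False obtain w where "w \<in> path_words \<sigma>" "length w = Suc (rank \<sigma>)" by blast
    with path_words_child[OF \<sigma>(1)] have "w @ [target \<tau>] \<in> path_words \<tau>"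
      "length (w @ [target \<tau>]) = Suc (rank \<tau>)"
      using False \<sigma>(2) by (simp_all add: rank.simps[of \<tau>])
    then show ?thesis by blast
  qed
qed

lemma path_length_le_rank:
  "is_path \<pi> (tree_of \<tau>) \<Longrightarrow> length (path_word (tree_of \<tau>) \<pi>) \<le> Suc (rank \<tau>)"
proof (induction \<pi> arbitrary: \<tau>)
  case Nil
  then show ?case by (simp add: tree_of.simps[of \<tau>])
next
  case (Cons i \<pi>)
  then have i: "i < length (arg_tys \<tau>)" "is_path \<pi> (tree_of (arg_tys \<tau> ! i))"
    by (auto simp: tree_of.simps[of \<tau>])
  then have "rank (arg_tys \<tau> ! i) \<le> Max (rank ` set (arg_tys \<tau>))" by (intro Max_ge) auto
  moreover have "rank \<tau> = Suc (Max (rank ` set (arg_tys \<tau>)))"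
    using i(1) by (auto simp: rank.simps[of \<tau>])
  ultimately have "Suc (rank (arg_tys \<tau> ! i)) \<le> rank \<tau>" by simp
  with Cons.IH[OF i(2)] i(1) show ?case by (simp add: tree_of.simps[of \<tau>])
qed

theorem proposition4p5:
  fixes \<rho> \<tau> :: "'a ty"
  shows "(\<rho> \<unlhd> \<tau> \<longrightarrow> rank \<rho> \<le> rank \<tau>) \<and>
    (\<forall>\<pi>. \<rho> \<unlhd> \<tau> \<and> is_path \<pi> (tree_of \<rho>) \<longrightarrow>
      (\<exists>\<pi>'. is_path \<pi>' (tree_of \<tau>) \<and> path_word (tree_of \<rho>) \<pi> \<sqsubseteq> path_word (tree_of \<tau>) \<pi>'))"
proof -
  have path: "\<exists>\<pi>'. is_path \<pi>' (tree_of \<tau>) \<and> path_word (tree_of \<rho>) \<pi> \<sqsubseteq> path_word (tree_of \<tau>) \<pi>'"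
    if "\<rho> \<unlhd> \<tau>" "is_path \<pi> (tree_of \<rho>)" for \<pi>
    using retr_path[OF that(2) retract_retr[OF that(1)]] unfolding path_words_def by blast
  have "rank \<rho> \<le> rank \<tau>" if "\<rho> \<unlhd> \<tau>"
  proof -
    obtain \<pi> where \<pi>: "is_path \<pi> (tree_of \<rho>)" "length (path_word (tree_of \<rho>) \<pi>) = Suc (rank \<rho>)"
      using rank_path[of \<rho>] unfolding path_words_def by blast
    from path[OF that \<pi>(1)] obtain \<pi>' where \<pi>': "is_path \<pi>' (tree_of \<tau>)"
      "path_word (tree_of \<rho>) \<pi> \<sqsubseteq> path_word (tree_of \<tau>) \<pi>'" by blast
    from word_le_length[OF \<pi>'(2)] path_length_le_rank[OF \<pi>'(1)] \<pi>(2) show ?thesis by simp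
  qed
  with path show ?thesis by blast
qed

end
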